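(* Let a DDE be given by constant matrices $A_0,B_1,B_2,C_{10},C_{20},D_{kl}$, $A_i,B_{ki},C_{ki},D_{kli}$ and bounded measurable matrix-valued functions $A_{di},B_{kdi},C_{kdi},D_{kldi}$ on $[-\tau_i,0]$ ($k,l\in\{1,2\}$, $i=1,\dots,K$), with delays $0<\tau_1<\dots<\tau_K$. Consider the DDF with the same $A_0,B_1,B_2,D_{11},D_{12},D_{21},D_{22}$, with $C_1=C_{10}$, $C_2=C_{20}$, with $n_v=n+q+r$ and $p_i=n+m+p$, and with $$\begin{bmatrix}B_v \\ D_{1v} \\ D_{2v}\end{bmatrix}=I,\quad \begin{bmatrix}C_{ri}&B_{r1i}&B_{r2i}\end{bmatrix}=I,\quad D_{rvi}=0,$$ $$C_{vi}=\begin{bmatrix}A_i & B_{1i} &B_{2i} \\ C_{1i} & D_{11i}&D_{12i} \\ C_{2i} & D_{21i}&D_{22i}\end{bmatrix},\quad C_{vdi}(s)=\begin{bmatrix}A_{di}(s) & B_{1di}(s) &B_{2di}(s) \\ C_{1di}(s) & D_{11di}(s)&D_{12di}(s) \\ C_{2di}(s) & D_{21di}(s)&D_{22di}(s)\end{bmatrix},\quad i=1,\dots,K.$$ Let $w\in W^{1,2}[0,\infty)^m$ and $u\in W^{1,2}[0,\infty)^p$ with $w(s)=0$, $u(s)=0$ for $s\le 0$, and let $x_0\in W^{1,2}[-\tau_K,0]^n$. Let $x:[-\tau_K,\infty)\to\mathbb{R}^n$, $z:[0,\infty)\to\mathbb{R}^q$, $y:[0,\infty)\to\mathbb{R}^r$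 be functions. Then $x,y,z$ satisfy the DDE for the given $u,w$ and initial condition $x_0$ if and only if $x|_{[0,\infty)},y,z$ together with $$r_i(t)=\begin{bmatrix}x(t) \\ w(t) \\ u(t)\end{bmatrix}\ (t\ge-\tau_i),\qquad i=1,\dots,K,$$ and the signal $v$ determined by the $r_i$ through the DDF equation for $v$, satisfy the DDF for the given $u,w$ and initial conditions $x_0(0)\in\mathbb{R}^n$ and $r_{i0}(s)=\begin{bmatrix}x_0(s) \\ 0 \\ 0\end{bmatrix}$, $s\in[-\tau_i,0]$, $i=1,\dots,K$.
   Context: All functions in $W^{1,2}$ are identified with their absolutely continuous representatives. The inputs $w,u$ are extended by $0$ to negative times. Derivatives at $t=0$ are from the right. Signal dimensions: $x(t)\in\mathbb{R}^n$, $w(t)\in\mathbb{R}^m$, $u(t)\in\mathbb{R}^p$, $z(t)\in\mathbb{R}^q$, $y(t)\in\mathbb{R}^r$; matrix dimensions are the compatible ones. **DDE.** For given $u,w$ and $x_0\in W^{1,2}[-\tau_K,0]^n$, functions $x:[-\tau_K,\infty)\to\mathbb{R}^n$, $z$, $y$ satisfy the DDE if $x$ is differentiable on $[0,\infty)$, $x(s)=x_0(s)$ for $s\in[-\tau_K,0]$, and for all $t\ge0$ $$\begin{bmatrix}\dot x(t) \\ z(t) \\ y(t)\end{bmatrix}=\begin{bmatrix}A_0 & B_1 & B_2 \\ C_{10} & D_{11} &D_{12} \\ C_{20} & D_{21} &D_{22}\end{bmatrix}\begin{bmatrix}x(t) \\ w(t) \\ u(t)\end{bmatrix}+\sum_{i=1}^K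 \begin{bmatrix}A_i & B_{1i} & B_{2i} \\ C_{1i} & D_{11i} & D_{12i} \\ C_{2i} & D_{21i} & D_{22i}\end{bmatrix} \begin{bmatrix}x(t-\tau_i) \\ w(t-\tau_i) \\ u(t-\tau_i)\end{bmatrix}+\sum_{i=1}^K \int_{-\tau_i}^0\begin{bmatrix}A_{di}(s) & B_{1di}(s) &B_{2di}(s) \\ C_{1di}(s) & D_{11di}(s) & D_{12di}(s) \\ C_{2di}(s) & D_{21di}(s) & D_{22di}(s)\end{bmatrix} \begin{bmatrix}x(t+s) \\ w(t+s) \\ u(t+s)\end{bmatrix}ds.$$ **DDF.** A DDF is given by matrices $A_0,B_k,C_k,D_{kl},B_v,D_{kv},C_{ri},B_{rki},D_{rvi},C_{vi}$ and bounded functions $C_{vdi}$. For given $u,w$ and initial conditions $\xi_0\in\mathbb{R}^n$, $r_{i0}\in W^{1,2}[-\tau_i,0]^{p_i}$ satisfying the sewing condition $$r_{i0}(0)=C_{ri}\xi_0+D_{rvi}\Big(\sum_{j=1}^K C_{vj} r_{j0}(-\tau_j)+\sum_{j=1}^K \int_{-\tau_j}^0C_{vdj}(s) r_{j0}(s)ds\Big),\quad i=1,\dots,K,$$ functions $x:[0,\infty)\to\mathbb{R}^n$, $z:[0,\infty)\to\mathbb{R}^q$, $y:[0,\infty)\to\mathbb{R}^r$, $r_i:[-\tau_i,\infty)\to\mathbb{R}^{p_i}$, $v:[0,\infty)\to\mathbb{R}^{n_v}$ satisfy the DDF if $x$ is differentiable on $[0,\infty)$, $x(0)=\xi_0$,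 $r_i(s)=r_{i0}(s)$ for $s\in[-\tau_i,0]$, $r_i(t+\cdot)\in W^{1,2}[-\tau_i,0]^{p_i}$ for all $t\ge 0$ and all $i$, and for all $t\ge0$, $i=1,\dots,K$, $$\begin{bmatrix}\dot x(t) \\ z(t) \\ y(t) \\ r_i(t)\end{bmatrix}=\begin{bmatrix}A_0 & B_1& B_2 \\ C_1 &D_{11}&D_{12} \\ C_2&D_{21}&D_{22} \\ C_{ri}&B_{r1i}&B_{r2i}\end{bmatrix}\begin{bmatrix}x(t) \\ w(t) \\ u(t)\end{bmatrix}+\begin{bmatrix}B_v \\ D_{1v} \\ D_{2v} \\ D_{rvi}\end{bmatrix} v(t),$$ $$v(t)=\sum_{i=1}^K C_{vi} r_i(t-\tau_i)+\sum_{i=1}^K \int_{-\tau_i}^0C_{vdi}(s) r_i(t+s)ds.$$ That the initial conditions meet the sewing condition is part of "satisfying the DDF". *)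

theory Defs
  imports "HOL-Analysis.Analysis"
begin

definition abs_cont_on :: "real set \<Rightarrow> (real \<Rightarrow> 'a::real_normed_vector) \<Rightarrow> bool" where
  "abs_cont_on S f \<longleftrightarrow>
    (\<forall>\<epsilon>>0. \<exists>\<delta>>0. \<forall>(N::nat) a b.
      (\<forall>i<N. a i \<le> b i \<and> a i \<in> S \<and> b i \<in> S) \<and>
      disjoint_family_on (\<lambda>i. {a i<..<b i}) {..<N} \<and>
      (\<Sum>i<N. b i - a i) < \<delta> \<longrightarrow>
      (\<Sum>i<N. norm (f (b i) - f (a i))) < \<epsilon>)"

definition L2_on :: "real set \<Rightarrow> (real \<Rightarrow> 'a::euclidean_space) \<Rightarrow> bool" where
  "L2_on S f \<longleftrightarrow>
    set_borel_measurable lebesgue S f \<and> set_integrable lebesgue S (\<lambda>t. (norm (f t))\<^sup>2)"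

text \<open>
  Elements of \<open>W12 S\<close>, for an interval \<open>S\<close>, are the absolutely continuous representatives
  themselves, not classes modulo null sets. On an unbounded interval absolute continuity is
  understood locally. Only the values on \<open>S\<close> matter.
\<close>

definition W12 :: "real set \<Rightarrow> (real \<Rightarrow> 'a::euclidean_space) set" where
  "W12 S = {f. (\<forall>a b. {a..b} \<subseteq> S \<longrightarrow> abs_cont_on {a..b} f) \<and> L2_on S f \<and>
    (\<exists>f'. L2_on S f' \<and>
      (AE t in lebesgue. t \<in> S \<longrightarrow> (f has_vector_derivative f' t) (at t within S)))}"

text \<open>
  Since a matrix is the vector of its rows, \<open>stack3\<close> stacks three column vectors as well as
  three matrices with the same number of columns.
\<close>

definition stack3 :: "'a^'i \<Rightarrow> 'a^'j \<Rightarrow> 'a^'k \<Rightarrow> 'a^('i + 'j + 'k)" where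
  "stack3 a b c = (\<chi> l. case l of Inl i \<Rightarrow> a $ i
     | Inr l' \<Rightarrow> (case l' of Inl j \<Rightarrow> b $ j | Inr k \<Rightarrow> c $ k))"

definition beside3 :: "'a^'i^'l \<Rightarrow> 'a^'j^'l \<Rightarrow> 'a^'k^'l \<Rightarrow> 'a^('i + 'j + 'k)^'l" where
  "beside3 A B C = (\<chi> l. stack3 (A $ l) (B $ l) (C $ l))"

text \<open>The nine blocks of a matrix that maps \<open>(x, w, u)\<close> to \<open>(x', z, y)\<close>.\<close>

record ('n::finite, 'm::finite, 'p::finite, 'q::finite, 'r::finite) blocks =
  blk_A :: "real^'n^'n"
  blk_B1 :: "real^'m^'n"
  blk_B2 :: "real^'p^'n"
  blk_C1 :: "real^'n^'q"
  blk_D11 :: "real^'m^'q"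
  blk_D12 :: "real^'p^'q"
  blk_C2 :: "real^'n^'r"
  blk_D21 :: "real^'m^'r"
  blk_D22 :: "real^'p^'r"

definition block_matrix ::
  "('n::finite, 'm::finite, 'p::finite, 'q::finite, 'r::finite) blocks \<Rightarrow>
    real^('n + 'm + 'p)^('n + 'q + 'r)" where
  "block_matrix M =
     stack3 (beside3 (blk_A M)  (blk_B1 M)  (blk_B2 M))
            (beside3 (blk_C1 M) (blk_D11 M) (blk_D12 M))
            (beside3 (blk_C2 M) (blk_D21 M) (blk_D22 M))"

text \<open>
  \<open>dde_now\<close> holds \<open>A\<^sub>0, B\<^sub>1, B\<^sub>2, C\<^sub>1\<^sub>0, D\<^sub>1\<^sub>1, \<dots>\<close>, \<open>dde_delay i\<close> holds \<open>A\<^sub>i, B\<^sub>1\<^sub>i, \<dots>\<close> and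
  \<open>dde_distr i s\<close> holds \<open>A\<^sub>d\<^sub>i(s), B\<^sub>1\<^sub>d\<^sub>i(s), \<dots>\<close>. The delays are \<open>\<tau> 1, \<dots>, \<tau> K\<close>.
\<close>

record ('n::finite, 'm::finite, 'p::finite, 'q::finite, 'r::finite) dde =
  dde_now :: "('n, 'm, 'p, 'q, 'r) blocks"
  dde_delay :: "nat \<Rightarrow> ('n, 'm, 'p, 'q, 'r) blocks"
  dde_distr :: "nat \<Rightarrow> real \<Rightarrow> ('n, 'm, 'p, 'q, 'r) blocks"

definition satisfies_DDE ::
  "nat \<Rightarrow> (nat \<Rightarrow> real) \<Rightarrow> ('n::finite, 'm::finite, 'p::finite, 'q::finite, 'r::finite) dde \<Rightarrow>
   (real \<Rightarrow> real^'m) \<Rightarrow> (real \<Rightarrow> real^'p) \<Rightarrow> (real \<Rightarrow> real^'n) \<Rightarrow>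
   (real \<Rightarrow> real^'n) \<Rightarrow> (real \<Rightarrow> real^'q) \<Rightarrow> (real \<Rightarrow> real^'r) \<Rightarrow> bool" where
  "satisfies_DDE K \<tau> E w u x0 x z y \<longleftrightarrow>
    x0 \<in> W12 {-\<tau> K..0} \<and>
    x differentiable_on {0..} \<and>
    (\<forall>s\<in>{-\<tau> K..0}. x s = x0 s) \<and>
    (\<forall>t\<ge>0.
      stack3 (vector_derivative x (at t within {0..})) (z t) (y t) =
        block_matrix (dde_now E) *v stack3 (x t) (w t) (u t)
        + (\<Sum>i=1..K. block_matrix (dde_delay E i) *v
              stack3 (x (t - \<tau> i)) (w (t - \<tau> i)) (u (t - \<tau> i)))
        + (\<Sum>i=1..K. LINT s:{-\<tau> i..0}|lebesgue.
              block_matrix (dde_distr E i s) *v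
              stack3 (x (t + s)) (w (t + s)) (u (t + s))))"

text \<open>
  The type variable \<open>'l\<close> indexes the components of every \<open>r\<^sub>i\<close>, and \<open>'v\<close> those of \<open>v\<close>. A system
  whose \<open>r\<^sub>i\<close> have different dimensions is covered by padding with zero rows in
  \<open>C\<^sub>r\<^sub>i, B\<^sub>r\<^sub>1\<^sub>i, B\<^sub>r\<^sub>2\<^sub>i, D\<^sub>r\<^sub>v\<^sub>i\<close> and zero columns in \<open>C\<^sub>v\<^sub>i, C\<^sub>v\<^sub>d\<^sub>i\<close>.
\<close>

record ('n::finite, 'm::finite, 'p::finite, 'q::finite, 'r::finite, 'l::finite, 'v::finite) ddf =
  ddf_A0 :: "real^'n^'n"
  ddf_B1 :: "real^'m^'n"
  ddf_B2 :: "real^'p^'n"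
  ddf_Bv :: "real^'v^'n"
  ddf_C1 :: "real^'n^'q"
  ddf_D11 :: "real^'m^'q"
  ddf_D12 :: "real^'p^'q"
  ddf_D1v :: "real^'v^'q"
  ddf_C2 :: "real^'n^'r"
  ddf_D21 :: "real^'m^'r"
  ddf_D22 :: "real^'p^'r"
  ddf_D2v :: "real^'v^'r"
  ddf_Cr :: "nat \<Rightarrow> real^'n^'l"
  ddf_Br1 :: "nat \<Rightarrow> real^'m^'l"
  ddf_Br2 :: "nat \<Rightarrow> real^'p^'l"
  ddf_Drv :: "nat \<Rightarrow> real^'v^'l"
  ddf_Cv :: "nat \<Rightarrow> real^'l^'v"
  ddf_Cvd :: "nat \<Rightarrow> real \<Rightarrow> real^'l^'v"

definition ddf_v ::
  "nat \<Rightarrow> (nat \<Rightarrow> real) \<Rightarrow>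
   ('n::finite, 'm::finite, 'p::finite, 'q::finite, 'r::finite, 'l::finite, 'v::finite) ddf \<Rightarrow>
   (nat \<Rightarrow> real \<Rightarrow> real^'l) \<Rightarrow> real \<Rightarrow> real^'v" where
  "ddf_v K \<tau> F r t =
     (\<Sum>i=1..K. ddf_Cv F i *v r i (t - \<tau> i))
     + (\<Sum>i=1..K. LINT s:{-\<tau> i..0}|lebesgue. ddf_Cvd F i s *v r i (t + s))"

text \<open>At time 0 the expression for \<open>v\<close> is exactly the bracket in the sewing condition.\<close>

definition sewing_condition ::
  "nat \<Rightarrow> (nat \<Rightarrow> real) \<Rightarrow>
   ('n::finite, 'm::finite, 'p::finite, 'q::finite, 'r::finite, 'l::finite, 'v::finite) ddf \<Rightarrow>
   real^'n \<Rightarrow> (nat \<Rightarrow> real \<Rightarrow> real^'l) \<Rightarrow> bool" where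
  "sewing_condition K \<tau> F \<xi>0 r0 \<longleftrightarrow>
    (\<forall>i\<in>{1..K}. r0 i 0 = ddf_Cr F i *v \<xi>0 + ddf_Drv F i *v ddf_v K \<tau> F r0 0)"

definition satisfies_DDF ::
  "nat \<Rightarrow> (nat \<Rightarrow> real) \<Rightarrow>
   ('n::finite, 'm::finite, 'p::finite, 'q::finite, 'r::finite, 'l::finite, 'v::finite) ddf \<Rightarrow>
   (real \<Rightarrow> real^'m) \<Rightarrow> (real \<Rightarrow> real^'p) \<Rightarrow> real^'n \<Rightarrow> (nat \<Rightarrow> real \<Rightarrow> real^'l) \<Rightarrow>
   (real \<Rightarrow> real^'n) \<Rightarrow> (real \<Rightarrow> real^'q) \<Rightarrow> (real \<Rightarrow> real^'r) \<Rightarrow>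
   (nat \<Rightarrow> real \<Rightarrow> real^'l) \<Rightarrow> (real \<Rightarrow> real^'v) \<Rightarrow> bool" where
  "satisfies_DDF K \<tau> F w u \<xi>0 r0 x z y r v \<longleftrightarrow>
    (\<forall>i\<in>{1..K}. r0 i \<in> W12 {-\<tau> i..0}) \<and>
    sewing_condition K \<tau> F \<xi>0 r0 \<and>
    x differentiable_on {0..} \<and>
    x 0 = \<xi>0 \<and>
    (\<forall>i\<in>{1..K}. \<forall>s\<in>{-\<tau> i..0}. r i s = r0 i s) \<and>
    (\<forall>t\<ge>0. \<forall>i\<in>{1..K}. (\<lambda>s. r i (t + s)) \<in> W12 {-\<tau> i..0}) \<and>
    (\<forall>t\<ge>0.
      vector_derivative x (at t within {0..}) =
        ddf_A0 F *v x t + ddf_B1 F *v w t + ddf_B2 F *v u t + ddf_Bv F *v v t \<and>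
      z t = ddf_C1 F *v x t + ddf_D11 F *v w t + ddf_D12 F *v u t + ddf_D1v F *v v t \<and>
      y t = ddf_C2 F *v x t + ddf_D21 F *v w t + ddf_D22 F *v u t + ddf_D2v F *v v t \<and>
      (\<forall>i\<in>{1..K}.
        r i t = ddf_Cr F i *v x t + ddf_Br1 F i *v w t + ddf_Br2 F i *v u t
                + ddf_Drv F i *v v t) \<and>
      v t = ddf_v K \<tau> F r t)"

end

theory Submission
  imports Defs
begin

text \<open>
  Stacking shows that the two systems of equations coincide: with identity blocks the DDF equation
  for \<open>r\<^sub>i\<close> reads \<open>r\<^sub>i = (x, w, u)\<close>, and \<open>v\<close> is exactly the delayed part of the DDE. The one
  analytic point is that a DDE solution satisfies \<open>r\<^sub>i(t + \<cdot>) \<in> W\<^sup>1\<^sup>,\<^sup>2\<close>. Since \<open>x\<close>, \<open>w\<close> and \<open>u\<close> are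
  bounded on compact intervals and the coefficients are bounded, the DDE bounds \<open>x'\<close> on every
  \<open>[0, T]\<close>; so \<open>x\<close> is Lipschitz there, and \<open>W\<^sup>1\<^sup>,\<^sup>2\<close> functions that agree at the common endpoint 0
  can be glued, as is also done for \<open>w\<close> and \<open>u\<close> with their extensions by 0.
\<close>

section \<open>Absolutely continuous functions\<close>

text \<open>Names the relation "\<open>\<delta>\<close> works for \<open>\<epsilon>\<close>", so
  that the nested quantifiers over finite interval families are handled once and a modulus can be
  passed on as a single fact.\<close>

definition ac_modulus :: "real set \<Rightarrow> (real \<Rightarrow> 'a::real_normed_vector) \<Rightarrow> real \<Rightarrow> real \<Rightarrow> bool" where
  "ac_modulus S f \<epsilon> \<delta> \<longleftrightarrow> \<delta> > 0 \<and>
    (\<forall>(N::nat) a b.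
      (\<forall>i<N. a i \<le> b i \<and> a i \<in> S \<and> b i \<in> S) \<and>
      disjoint_family_on (\<lambda>i. {a i<..<b i}) {..<N} \<and>
      (\<Sum>i<N. b i - a i) < \<delta> \<longrightarrow>
      (\<Sum>i<N. norm (f (b i) - f (a i))) < \<epsilon>)"

lemma abs_cont_on_iff_ac_modulus: "abs_cont_on S f \<longleftrightarrow> (\<forall>\<epsilon>>0. \<exists>\<delta>. ac_modulus S f \<epsilon> \<delta>)"
  unfolding abs_cont_on_def ac_modulus_def by blast

lemma abs_cont_onI:
  assumes "\<And>\<epsilon>. \<epsilon> > 0 \<Longrightarrow> \<exists>\<delta>. ac_modulus S f \<epsilon> \<delta>"
  shows "abs_cont_on S f"
  using assms by (simp add: abs_cont_on_iff_ac_modulus)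

lemma abs_cont_onD:
  assumes "abs_cont_on S f" "\<epsilon> > 0"
  obtains \<delta> where "ac_modulus S f \<epsilon> \<delta>"
  using assms unfolding abs_cont_on_iff_ac_modulus by blast

lemma ac_modulusI:
  assumes "\<delta> > 0"
    and "\<And>(N::nat) a b. \<lbrakk>\<And>i. i < N \<Longrightarrow> a i \<le> b i \<and> a i \<in> S \<and> b i \<in> S;
       disjoint_family_on (\<lambda>i. {a i<..<b i}) {..<N}; (\<Sum>i<N. b i - a i) < \<delta>\<rbrakk>
       \<Longrightarrow> (\<Sum>i<N. norm (f (b i) - f (a i))) < \<epsilon>"
  shows "ac_modulus S f \<epsilon> \<delta>"
  using assms unfolding ac_modulus_def by blast

lemma ac_modulus_pos: "ac_modulus S f \<epsilon> \<delta> \<Longrightarrow> \<delta> > 0"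
  by (simp add: ac_modulus_def)

lemma ac_modulusD:
  fixes N :: nat
  assumes "ac_modulus S f \<epsilon> \<delta>" "\<And>i. i < N \<Longrightarrow> a i \<le> b i \<and> a i \<in> S \<and> b i \<in> S"
    "disjoint_family_on (\<lambda>i. {a i<..<b i}) {..<N}" "(\<Sum>i<N. b i - a i) < \<delta>"
  shows "(\<Sum>i<N. norm (f (b i) - f (a i))) < \<epsilon>"
  using assms unfolding ac_modulus_def by blast

lemma abs_cont_on_subset: "abs_cont_on S f \<Longrightarrow> T \<subseteq> S \<Longrightarrow> abs_cont_on T f"
  unfolding abs_cont_on_def by (meson subsetD)

text \<open>A modulus of \<open>f\<close> for a rescaled \<open>\<epsilon>\<close> serves
  \<open>g\<close>. Only increments are compared, so the same lemma covers equality on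
  \<open>S\<close>, linear images, removal of additive constants, and Lipschitz functions (with
  \<open>f\<close> the identity).\<close>

lemma abs_cont_on_lipschitz_compose:
  assumes f: "abs_cont_on S f" and L: "\<And>s t. s \<in> S \<Longrightarrow> t \<in> S \<Longrightarrow> norm (g s - g t) \<le> L * norm (f s - f t)"
  shows "abs_cont_on S g"
proof (rule abs_cont_onI)
  fix \<epsilon> :: real assume "\<epsilon> > 0"
  \<comment> \<open>The sign of \<open>L\<close> is not known, and \<open>\<epsilon>\<close> is to
    be divided by the constant.\<close>
  define L' where "L' = max L 1"
  have "L' > 0" by (simp add: L'_def)
  with \<open>\<epsilon> > 0\<close> have "\<epsilon> / L' > 0" by simp
  from f this obtain \<delta> where \<delta>: "ac_modulus S f (\<epsilon> / L') \<delta>" by (rule abs_cont_onD)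
  have "ac_modulus S g \<epsilon> \<delta>"
  proof (rule ac_modulusI[OF ac_modulus_pos[OF \<delta>]])
    fix N :: nat and a b :: "nat \<Rightarrow> real"
    assume H: "\<And>i. i < N \<Longrightarrow> a i \<le> b i \<and> a i \<in> S \<and> b i \<in> S"
      "disjoint_family_on (\<lambda>i. {a i<..<b i}) {..<N}" "(\<Sum>i<N. b i - a i) < \<delta>"
    have "(\<Sum>i<N. norm (g (b i) - g (a i))) \<le> (\<Sum>i<N. L' * norm (f (b i) - f (a i)))"
    proof (rule sum_mono)
      fix i assume "i \<in> {..<N}"
      then have "norm (g (b i) - g (a i)) \<le> L * norm (f (b i) - f (a i))" using H(1) L by auto
      also have "\<dots> \<le> L' * norm (f (b i) - f (a i))"
        by (intro mult_right_mono) (auto simp: L'_def)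
      finally show "norm (g (b i) - g (a i)) \<le> L' * norm (f (b i) - f (a i))" .
    qed
    also have "\<dots> = L' * (\<Sum>i<N. norm (f (b i) - f (a i)))" by (simp add: sum_distrib_left)
    also have "\<dots> < L' * (\<epsilon> / L')"
      using \<open>L' > 0\<close> by (intro mult_strict_left_mono ac_modulusD[OF \<delta>] H)
    finally show "(\<Sum>i<N. norm (g (b i) - g (a i))) < \<epsilon>" using \<open>L' > 0\<close> by simp
  qed
  then show "\<exists>\<delta>. ac_modulus S g \<epsilon> \<delta>" ..
qed

lemma abs_cont_on_cong:
  assumes "\<And>t. t \<in> S \<Longrightarrow> f t = g t"
  shows "abs_cont_on S f \<longleftrightarrow> abs_cont_on S g"
proof
  show "abs_cont_on S g" if "abs_cont_on S f"
    by (rule abs_cont_on_lipschitz_compose[OF that, where L = 1]) (simp add: assms)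
  show "abs_cont_on S f" if "abs_cont_on S g"
    by (rule abs_cont_on_lipschitz_compose[OF that, where L = 1]) (simp add: assms)
qed

lemma abs_cont_on_id: "abs_cont_on S (\<lambda>t. t)"
proof (rule abs_cont_onI)
  fix \<epsilon> :: real assume "\<epsilon> > 0"
  have "ac_modulus S (\<lambda>t. t) \<epsilon> \<epsilon>"
  proof (rule ac_modulusI[OF \<open>\<epsilon> > 0\<close>])
    fix N :: nat and a b :: "nat \<Rightarrow> real"
    assume H: "\<And>i. i < N \<Longrightarrow> a i \<le> b i \<and> a i \<in> S \<and> b i \<in> S" "(\<Sum>i<N. b i - a i) < \<epsilon>"
    have "(\<Sum>i<N. norm (b i - a i)) = (\<Sum>i<N. b i - a i)"
      using H(1) by (intro sum.cong) auto
    with H(2) show "(\<Sum>i<N. norm (b i - a i)) < \<epsilon>" by simp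
  qed
  then show "\<exists>\<delta>. ac_modulus S (\<lambda>t. t) \<epsilon> \<delta>" ..
qed

lemma abs_cont_on_add:
  assumes "abs_cont_on S f" "abs_cont_on S g"
  shows "abs_cont_on S (\<lambda>t. f t + g t)"
proof (rule abs_cont_onI)
  fix \<epsilon> :: real assume "\<epsilon> > 0"
  then have e: "\<epsilon> / 2 > 0" by simp
  obtain \<delta> where \<delta>: "ac_modulus S f (\<epsilon> / 2) \<delta>" by (rule abs_cont_onD[OF assms(1) e])
  obtain \<delta>' where \<delta>': "ac_modulus S g (\<epsilon> / 2) \<delta>'" by (rule abs_cont_onD[OF assms(2) e])
  have "ac_modulus S (\<lambda>t. f t + g t) \<epsilon> (min \<delta> \<delta>')"
  proof (rule ac_modulusI)
    show "min \<delta> \<delta>' > 0" using ac_modulus_pos[OF \<delta>] ac_modulus_pos[OF \<delta>'] by simp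
    fix N :: nat and a b :: "nat \<Rightarrow> real"
    assume H: "\<And>i. i < N \<Longrightarrow> a i \<le> b i \<and> a i \<in> S \<and> b i \<in> S"
      "disjoint_family_on (\<lambda>i. {a i<..<b i}) {..<N}" "(\<Sum>i<N. b i - a i) < min \<delta> \<delta>'"
    have "(\<Sum>i<N. norm (f (b i) + g (b i) - (f (a i) + g (a i))))
        \<le> (\<Sum>i<N. norm (f (b i) - f (a i)) + norm (g (b i) - g (a i)))"
      by (intro sum_mono norm_diff_triangle_ineq)
    also have "\<dots> < \<epsilon> / 2 + \<epsilon> / 2"
      unfolding sum.distrib using H(3)
      by (intro add_strict_mono ac_modulusD[OF \<delta>] ac_modulusD[OF \<delta>'] H) auto
    finally show "(\<Sum>i<N. norm (f (b i) + g (b i) - (f (a i) + g (a i)))) < \<epsilon>" by simp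
  qed
  then show "\<exists>\<delta>. ac_modulus S (\<lambda>t. f t + g t) \<epsilon> \<delta>" ..
qed

text \<open>The hypothesis \<open>sub\<close> keeps the images of disjoint open intervals disjoint.\<close>

lemma abs_cont_on_compose_mono:
  assumes f: "abs_cont_on S f" and h: "mono h" "h ` T \<subseteq> S" "\<And>s t. \<bar>h s - h t\<bar> \<le> \<bar>s - t\<bar>"
    and sub: "\<And>a b t. h a < t \<Longrightarrow> t < h b \<Longrightarrow> \<exists>s. a < s \<and> s < b \<and> h s = t"
  shows "abs_cont_on T (\<lambda>t. f (h t))"
proof (rule abs_cont_onI)
  fix \<epsilon> :: real assume "\<epsilon> > 0"
  with f obtain \<delta> where \<delta>: "ac_modulus S f \<epsilon> \<delta>" by (rule abs_cont_onD)
  have "ac_modulus T (\<lambda>t. f (h t)) \<epsilon> \<delta>"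
  proof (rule ac_modulusI[OF ac_modulus_pos[OF \<delta>]])
    fix N :: nat and a b :: "nat \<Rightarrow> real"
    assume H: "\<And>i. i < N \<Longrightarrow> a i \<le> b i \<and> a i \<in> T \<and> b i \<in> T"
      "disjoint_family_on (\<lambda>i. {a i<..<b i}) {..<N}" "(\<Sum>i<N. b i - a i) < \<delta>"
    show "(\<Sum>i<N. norm (f (h (b i)) - f (h (a i)))) < \<epsilon>"
    proof (rule ac_modulusD[OF \<delta>])
      show "h (a i) \<le> h (b i) \<and> h (a i) \<in> S \<and> h (b i) \<in> S" if "i < N" for i
        using H(1) h(1,2) that by (auto dest: monoD)
      show "disjoint_family_on (\<lambda>i. {h (a i)<..<h (b i)}) {..<N}"
        unfolding disjoint_family_on_def
      proof (intro ballI impI)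
        fix i j assume ij: "i \<in> {..<N}" "j \<in> {..<N}" "i \<noteq> j"
        show "{h (a i)<..<h (b i)} \<inter> {h (a j)<..<h (b j)} = {}"
        proof (rule equals0I)
          fix t assume t: "t \<in> {h (a i)<..<h (b i)} \<inter> {h (a j)<..<h (b j)}"
          \<comment> \<open>Only the interval \<open>i\<close> needs the lifting property
            \<open>sub\<close>. Monotonicity then forces this same \<open>s\<close> into the
            interval \<open>j\<close>: for instance, \<open>s \<le> a j\<close> would give
            \<open>h s \<le> h (a j) < t\<close>.\<close>
          obtain s where s: "a i < s" "s < b i" "h s = t" using t sub[of "a i" t "b i"] by auto
          have "a j < s" "s < b j" using t s(3) monoD[OF h(1), of s "a j"] monoD[OF h(1), of "b j" s]
            by (auto simp: not_le[symmetric])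
          with s have "s \<in> {a i<..<b i} \<inter> {a j<..<b j}" by simp
          with disjoint_family_onD[OF H(2) ij] show False by blast
        qed
      qed
      have "(\<Sum>i<N. h (b i) - h (a i)) \<le> (\<Sum>i<N. b i - a i)"
      proof (rule sum_mono)
        fix i assume "i \<in> {..<N}"
        then show "h (b i) - h (a i) \<le> b i - a i" using H(1)[of i] h(3)[of "b i" "a i"] by auto
      qed
      with H(3) show "(\<Sum>i<N. h (b i) - h (a i)) < \<delta>" by simp
    qed
  qed
  then show "\<exists>\<delta>. ac_modulus T (\<lambda>t. f (h t)) \<epsilon> \<delta>" ..
qed

lemma abs_cont_on_translate:
  assumes "abs_cont_on ((+) c ` S) f"
  shows "abs_cont_on S (\<lambda>t. f (c + t))"
proof (rule abs_cont_on_compose_mono[OF assms])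
  show "\<exists>s. a < s \<and> s < b \<and> c + s = t" if "c + a < t" "t < c + b" for a b t
    using that by (intro exI[of _ "t - c"]) auto
qed (auto intro: monoI)

text \<open>Clamping the argument at \<open>b\<close> avoids cutting intervals that straddle
  \<open>b\<close>: since \<open>f (min t b) + f (max t b) = f t + f b\<close>, the function
  \<open>f\<close> is, up to a constant, a sum of one function controlled on \<open>{a..b}\<close>
  and one controlled on \<open>{b..c}\<close>.\<close>

lemma abs_cont_on_join:
  fixes f :: "real \<Rightarrow> 'a::real_normed_vector"
  assumes f: "abs_cont_on {a..b} f" "abs_cont_on {b..c} f" and le: "a \<le> b" "b \<le> c"
  shows "abs_cont_on {a..c} f"
proof -
  have "abs_cont_on {a..c} (\<lambda>t. f (min t b))"
  proof (rule abs_cont_on_compose_mono[OF f(1)])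
    show "\<exists>s. a < s \<and> s < a' \<and> min s b = t" if "min a b < t" "t < min a' b" for a a' t
      using that by (intro exI[of _ t]) auto
  qed (use le in \<open>auto intro: monoI\<close>)
  moreover have "abs_cont_on {a..c} (\<lambda>t. f (max t b))"
  proof (rule abs_cont_on_compose_mono[OF f(2)])
    show "\<exists>s. a < s \<and> s < a' \<and> max s b = t" if "max a b < t" "t < max a' b" for a a' t
      using that by (intro exI[of _ t]) (auto simp: max_def split: if_splits)
  qed (use le in \<open>auto intro: monoI\<close>)
  ultimately have "abs_cont_on {a..c} (\<lambda>t. f (min t b) + f (max t b))"
    by (rule abs_cont_on_add)
  moreover have "f (min t b) + f (max t b) = f t + f b" for t
    by (simp add: min_def max_def)
  ultimately have "abs_cont_on {a..c} (\<lambda>t. f t + f b)" by simp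
  then show ?thesis by (rule abs_cont_on_lipschitz_compose[where L = 1]) simp
qed

lemma abs_cont_on_imp_continuous_on:
  assumes "abs_cont_on S f"
  shows "continuous_on S f"
proof (unfold continuous_on_iff, intro ballI allI impI)
  fix t and \<epsilon> :: real assume "t \<in> S" "\<epsilon> > 0"
  obtain \<delta> where \<delta>: "ac_modulus S f \<epsilon> \<delta>"
    by (rule abs_cont_onD[OF assms \<open>\<epsilon> > 0\<close>])
  have "dist (f s) (f t) < \<epsilon>" if s: "s \<in> S" "dist s t < \<delta>" for s
    \<comment> \<open>The family consists of the single interval between \<open>s\<close> and
      \<open>t\<close>; \<open>min\<close> and \<open>max\<close> put its endpoints in
      order.\<close>
    using ac_modulusD[OF \<delta>, of "Suc 0" "\<lambda>_. min s t" "\<lambda>_. max s t"] s \<open>t \<in> S\<close>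
    by (cases "s \<le> t") (auto simp: lessThan_Suc disjoint_family_on_def dist_norm norm_minus_commute)
  with ac_modulus_pos[OF \<delta>] show "\<exists>d>0. \<forall>x'\<in>S. dist x' t < d \<longrightarrow> dist (f x') (f t) < \<epsilon>"
    by blast
qed

section \<open>Square integrable functions\<close>

lemma set_borel_measurable_subset_lebesgue:
  fixes f :: "real \<Rightarrow> 'a::euclidean_space"
  assumes "set_borel_measurable lebesgue S f" "T \<in> sets lebesgue" "T \<subseteq> S"
  shows "set_borel_measurable lebesgue T f"
proof -
  have "(\<lambda>t. indicat_real T t *\<^sub>R (indicat_real S t *\<^sub>R f t)) \<in> borel_measurable lebesgue"
    using borel_measurable_indicator[OF assms(2)] assms(1) unfolding set_borel_measurable_def
    by (rule borel_measurable_scaleR)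
  moreover have "indicat_real T t *\<^sub>R (indicat_real S t *\<^sub>R f t) = indicat_real T t *\<^sub>R f t" for t
    using assms(3) by (auto simp: indicator_def)
  ultimately show ?thesis unfolding set_borel_measurable_def by (simp only:)
qed

lemma L2_on_subset:
  assumes "L2_on S f" "T \<in> sets lebesgue" "T \<subseteq> S"
  shows "L2_on T f"
  using assms unfolding L2_on_def
  by (meson set_borel_measurable_subset_lebesgue set_integrable_subset)

lemma L2_on_cong:
  assumes "\<And>t. t \<in> S \<Longrightarrow> f t = g t"
  shows "L2_on S f \<longleftrightarrow> L2_on S g"
proof -
  have "(\<lambda>t. indicat_real S t *\<^sub>R f t) = (\<lambda>t. indicat_real S t *\<^sub>R g t)"
    "(\<lambda>t. indicat_real S t *\<^sub>R (norm (f t))\<^sup>2) = (\<lambda>t. indicat_real S t *\<^sub>R (norm (g t))\<^sup>2)"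
    using assms by (auto simp: indicator_def fun_eq_iff)
  then show ?thesis by (simp add: L2_on_def set_borel_measurable_def set_integrable_def)
qed

text \<open>Reduces square integrability to measurability and an integrable majorant, the form in
  which sums, linear images and bounded functions are treated.\<close>

lemma L2_on_dominated:
  fixes f :: "real \<Rightarrow> 'a::euclidean_space"
  assumes "set_integrable lebesgue S h" "set_borel_measurable lebesgue S f"
    and "\<And>t. t \<in> S \<Longrightarrow> (norm (f t))\<^sup>2 \<le> h t"
  shows "L2_on S f"
proof -
  have "(\<lambda>t. (norm (indicat_real S t *\<^sub>R f t))\<^sup>2) \<in> borel_measurable lebesgue"
    using assms(2) unfolding set_borel_measurable_def by measurable
  moreover have "(norm (indicat_real S t *\<^sub>R f t))\<^sup>2 = indicat_real S t *\<^sub>R (norm (f t))\<^sup>2" for t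
    by (simp add: indicator_def)
  ultimately have "set_borel_measurable lebesgue S (\<lambda>t. (norm (f t))\<^sup>2)"
    by (simp add: set_borel_measurable_def)
  with assms(1) have "set_integrable lebesgue S (\<lambda>t. (norm (f t))\<^sup>2)"
  proof (rule set_integrable_bound, intro AE_I2 impI)
    fix t assume "t \<in> S"
    with assms(3)[of t] show "norm ((norm (f t))\<^sup>2) \<le> norm (h t)" by simp
  qed
  with assms(2) show ?thesis by (simp add: L2_on_def)
qed

lemma L2_on_add:
  assumes "L2_on S f" "L2_on S g"
  shows "L2_on S (\<lambda>t. f t + g t)"
proof (rule L2_on_dominated)
  show "set_integrable lebesgue S (\<lambda>t. 2 * (norm (f t))\<^sup>2 + 2 * (norm (g t))\<^sup>2)"
    using assms by (intro set_integral_add set_integrable_mult_right) (auto simp: L2_on_def)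
  show "set_borel_measurable lebesgue S (\<lambda>t. f t + g t)"
    using assms unfolding L2_on_def set_borel_measurable_def scaleR_add_right
    by (intro borel_measurable_add) auto
  fix t
  have "(norm (f t + g t))\<^sup>2 \<le> (norm (f t) + norm (g t))\<^sup>2"
    by (intro power_mono norm_triangle_ineq) auto
  also have "\<dots> \<le> 2 * (norm (f t))\<^sup>2 + 2 * (norm (g t))\<^sup>2"
    using sum_squares_bound[of "norm (f t)" "norm (g t)"] by (simp add: power2_sum)
  finally show "(norm (f t + g t))\<^sup>2 \<le> 2 * (norm (f t))\<^sup>2 + 2 * (norm (g t))\<^sup>2" .
qed

lemma L2_on_linear_image:
  assumes "L2_on S f" "bounded_linear L"
  shows "L2_on S (\<lambda>t. L (f t))"
proof -
  obtain B where B: "\<And>x. norm (L x) \<le> norm x * B"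
    using bounded_linear.bounded[OF assms(2)] by blast
  show ?thesis
  proof (rule L2_on_dominated)
    show "set_integrable lebesgue S (\<lambda>t. B\<^sup>2 * (norm (f t))\<^sup>2)"
      using assms(1) by (intro set_integrable_mult_right) (auto simp: L2_on_def)
    have "(\<lambda>t. L (indicat_real S t *\<^sub>R f t)) \<in> borel_measurable lebesgue"
      using assms(1) borel_measurable_continuous_onI[OF linear_continuous_on[OF assms(2)]]
      unfolding L2_on_def set_borel_measurable_def by (auto intro: measurable_compose)
    then show "set_borel_measurable lebesgue S (\<lambda>t. L (f t))"
      by (simp add: set_borel_measurable_def linear_cmul[OF bounded_linear.linear[OF assms(2)]])
    fix t
    have "(norm (L (f t)))\<^sup>2 \<le> (norm (f t) * B)\<^sup>2" by (intro power_mono B) auto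
    then show "(norm (L (f t)))\<^sup>2 \<le> B\<^sup>2 * (norm (f t))\<^sup>2" by (simp add: power_mult_distrib mult.commute)
  qed
qed

lemma L2_on_Un:
  assumes f: "L2_on S f" "L2_on T f" and S: "S \<in> sets lebesgue" "T \<in> sets lebesgue"
  shows "L2_on (S \<union> T) f"
proof -
  have "set_borel_measurable lebesgue (S \<union> T) f"
  proof -
    \<comment> \<open>Adding the indicators of \<open>S\<close> and \<open>T\<close> would count the
      overlap twice, hence \<open>T - S\<close>.\<close>
    have "set_borel_measurable lebesgue (T - S) f"
      using f(2) S unfolding L2_on_def by (auto intro: set_borel_measurable_subset_lebesgue)
    with f(1) have "(\<lambda>t. indicat_real S t *\<^sub>R f t + indicat_real (T - S) t *\<^sub>R f t) \<in> borel_measurable lebesgue"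
      unfolding L2_on_def set_borel_measurable_def by (intro borel_measurable_add) auto
    moreover have "indicat_real S t *\<^sub>R f t + indicat_real (T - S) t *\<^sub>R f t = indicat_real (S \<union> T) t *\<^sub>R f t" for t
      by (simp add: indicator_def)
    ultimately show ?thesis by (simp add: set_borel_measurable_def)
  qed
  with assms show ?thesis by (auto simp: L2_on_def intro: set_integrable_Un)
qed

text \<open>Henstock-Kurzweil integrability supplies the measurability. It is available for every
  derivative through the fundamental theorem of calculus, even a discontinuous one.\<close>

lemma L2_on_bounded:
  fixes f :: "real \<Rightarrow> 'a::euclidean_space"
  assumes "f integrable_on {a..b}" "\<And>t. t \<in> {a..b} \<Longrightarrow> norm (f t) \<le> C"
  shows "L2_on {a..b} f"
proof (rule L2_on_dominated)
  show "set_integrable lebesgue {a..b} (\<lambda>t. C\<^sup>2)"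
    by (rule absolutely_integrable_on_const) simp
  have "f \<in> borel_measurable (lebesgue_on {a..b})"
    by (rule integrable_imp_measurable[OF assms(1)])
  then show "set_borel_measurable lebesgue {a..b} f"
    by (simp add: set_borel_measurable_def borel_measurable_restrict_space_iff)
  show "(norm (f t))\<^sup>2 \<le> C\<^sup>2" if "t \<in> {a..b}" for t
    using assms(2)[OF that] by (intro power_mono) auto
qed

section \<open>Invariance of Lebesgue measure and square integrability under translation\<close>

lemma lebesgue_translate_measurable: "(+) c \<in> lebesgue \<rightarrow>\<^sub>M lebesgue" for c :: real
  using lebesgue_affine_measurable[of "\<lambda>_. 1" c] by simp

lemma lebesgue_distr_translate: "distr lebesgue lebesgue ((+) c) = lebesgue" for c :: real
  using lebesgue_real_affine[of 1 c] by (simp add: density_1 cong: distr_cong)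

text \<open>A measure-preserving map pulls null sets back to null sets. This moves the almost
  everywhere derivative along with its function in \<open>W12_translate\<close>.\<close>

lemma AE_lebesgue_translate:
  fixes c :: real
  assumes "AE t in lebesgue. P t"
  shows "AE t in lebesgue. P (c + t)"
proof (rule AE_distrD[OF lebesgue_translate_measurable])
  show "AE t in distr lebesgue lebesgue ((+) c). P t"
    using assms by (simp only: lebesgue_distr_translate)
qed

lemma L2_on_translate:
  assumes "L2_on ((+) c ` S) f"
  shows "L2_on S (\<lambda>t. f (c + t))"
proof -
  have ind: "indicat_real ((+) c ` S) (c + t) = indicat_real S t" for t
    by (auto simp: indicator_def)
  have "(\<lambda>t. indicat_real ((+) c ` S) (c + t) *\<^sub>R f (c + t)) \<in> borel_measurable lebesgue"
    using assms unfolding L2_on_def set_borel_measurable_def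
    by (intro measurable_compose[OF lebesgue_translate_measurable]) auto
  \<comment> \<open>The factor \<open>1\<close> gives the integrand the shape of an affine
    substitution, here with slope 1.\<close>
  moreover have "integrable lebesgue (\<lambda>t. indicat_real ((+) c ` S) (c + 1 * t) *\<^sub>R (norm (f (c + 1 * t)))\<^sup>2)"
    using assms unfolding L2_on_def set_integrable_def
    by (intro lebesgue_integrable_real_affine) auto
  ultimately show ?thesis
    by (simp add: L2_on_def set_borel_measurable_def set_integrable_def ind)
qed

section \<open>The space \<open>W\<^sup>1\<^sup>,\<^sup>2\<close>\<close>

lemma W12I:
  assumes "\<And>a b. {a..b} \<subseteq> S \<Longrightarrow> abs_cont_on {a..b} f" "L2_on S f" "L2_on S f'"
    "AE t in lebesgue. t \<in> S \<longrightarrow> (f has_vector_derivative f' t) (at t within S)"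
  shows "f \<in> W12 S"
  using assms unfolding W12_def by blast

lemma W12_E:
  assumes "f \<in> W12 S"
  obtains f' where "\<And>a b. {a..b} \<subseteq> S \<Longrightarrow> abs_cont_on {a..b} f" "L2_on S f" "L2_on S f'"
    "AE t in lebesgue. t \<in> S \<longrightarrow> (f has_vector_derivative f' t) (at t within S)"
  using assms unfolding W12_def by blast

lemma W12_subset:
  assumes "f \<in> W12 S" "T \<in> sets lebesgue" "T \<subseteq> S"
  shows "f \<in> W12 T"
  using assms(1)
proof (rule W12_E)
  fix f' assume f: "\<And>a b. {a..b} \<subseteq> S \<Longrightarrow> abs_cont_on {a..b} f" "L2_on S f" "L2_on S f'"
    "AE t in lebesgue. t \<in> S \<longrightarrow> (f has_vector_derivative f' t) (at t within S)"
  show ?thesis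
  proof (rule W12I)
    show "AE t in lebesgue. t \<in> T \<longrightarrow> (f has_vector_derivative f' t) (at t within T)"
      using f(4)
    proof eventually_elim
      case (elim t)
      with assms(3) show ?case by (blast intro: has_vector_derivative_within_subset)
    qed
  qed (use f assms in \<open>auto intro: L2_on_subset\<close>)
qed

text \<open>Derivatives are taken within \<open>S\<close>, so agreement on \<open>S\<close>
  transfers them even at endpoints.\<close>

lemma W12_cong:
  assumes "f \<in> W12 S" and eq: "\<And>t. t \<in> S \<Longrightarrow> f t = g t"
  shows "g \<in> W12 S"
  using assms(1)
proof (rule W12_E)
  fix f' assume f: "\<And>a b. {a..b} \<subseteq> S \<Longrightarrow> abs_cont_on {a..b} f" "L2_on S f" "L2_on S f'"
    "AE t in lebesgue. t \<in> S \<longrightarrow> (f has_vector_derivative f' t) (at t within S)"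
  show ?thesis
  proof (rule W12I)
    show "abs_cont_on {a..b} g" if "{a..b} \<subseteq> S" for a b
      using f(1)[OF that] that eq abs_cont_on_cong[of "{a..b}" f g] by blast
    show "L2_on S g" using f(2) eq L2_on_cong by blast
    show "AE t in lebesgue. t \<in> S \<longrightarrow> (g has_vector_derivative f' t) (at t within S)"
      using f(4)
    proof eventually_elim
      case (elim t)
      then show ?case by (metis eq has_vector_derivative_transform)
    qed
  qed (use f in auto)
qed

lemma W12_add:
  assumes "f \<in> W12 S" "g \<in> W12 S"
  shows "(\<lambda>t. f t + g t) \<in> W12 S"
proof -
  obtain f' where f: "\<And>a b. {a..b} \<subseteq> S \<Longrightarrow> abs_cont_on {a..b} f" "L2_on S f" "L2_on S f'"
    "AE t in lebesgue. t \<in> S \<longrightarrow> (f has_vector_derivative f' t) (at t within S)"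
    using assms(1) by (rule W12_E) blast
  obtain g' where g: "\<And>a b. {a..b} \<subseteq> S \<Longrightarrow> abs_cont_on {a..b} g" "L2_on S g" "L2_on S g'"
    "AE t in lebesgue. t \<in> S \<longrightarrow> (g has_vector_derivative g' t) (at t within S)"
    using assms(2) by (rule W12_E) blast
  show ?thesis
  proof (rule W12I)
    show "AE t in lebesgue. t \<in> S \<longrightarrow>
        ((\<lambda>t. f t + g t) has_vector_derivative f' t + g' t) (at t within S)"
      using f(4) g(4) by eventually_elim (auto intro: has_vector_derivative_add)
  qed (use f g in \<open>auto intro: abs_cont_on_add L2_on_add\<close>)
qed

lemma W12_linear_image:
  assumes "f \<in> W12 S" and L: "bounded_linear L"
  shows "(\<lambda>t. L (f t)) \<in> W12 S"
  using assms(1)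
proof (rule W12_E)
  fix f' assume f: "\<And>a b. {a..b} \<subseteq> S \<Longrightarrow> abs_cont_on {a..b} f" "L2_on S f" "L2_on S f'"
    "AE t in lebesgue. t \<in> S \<longrightarrow> (f has_vector_derivative f' t) (at t within S)"
  obtain B where B: "\<And>x. norm (L x) \<le> norm x * B"
    using bounded_linear.bounded[OF L] by blast
  have "norm (L (f s) - L (f t)) \<le> B * norm (f s - f t)" for s t
    using B[of "f s - f t"] by (simp add: linear_diff[OF bounded_linear.linear[OF L]] mult.commute)
  then have "abs_cont_on {a..b} (\<lambda>t. L (f t))" if "{a..b} \<subseteq> S" for a b
    by (rule abs_cont_on_lipschitz_compose[OF f(1)[OF that]])
  moreover have "AE t in lebesgue. t \<in> S \<longrightarrow>
      ((\<lambda>t. L (f t)) has_vector_derivative L (f' t)) (at t within S)"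
    using f(4) by eventually_elim (auto intro: bounded_linear.has_vector_derivative[OF L])
  ultimately show ?thesis
    using L2_on_linear_image[OF f(2) L] L2_on_linear_image[OF f(3) L] by (intro W12I)
qed

text \<open>Turns regularity on a window \<open>{t - \<tau> i..t}\<close> into regularity of the
  history segment that the DDF asks for. Almost everywhere differentiability moves by the chain rule
  with inner derivative 1.\<close>

lemma W12_translate:
  assumes "f \<in> W12 ((+) c ` S)"
  shows "(\<lambda>t. f (c + t)) \<in> W12 S"
  using assms
proof (rule W12_E)
  fix f' assume f: "\<And>a b. {a..b} \<subseteq> (+) c ` S \<Longrightarrow> abs_cont_on {a..b} f"
    "L2_on ((+) c ` S) f" "L2_on ((+) c ` S) f'"
    "AE t in lebesgue. t \<in> (+) c ` S \<longrightarrow> (f has_vector_derivative f' t) (at t within (+) c ` S)"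
  show ?thesis
  proof (rule W12I)
    show "abs_cont_on {a..b} (\<lambda>t. f (c + t))" if "{a..b} \<subseteq> S" for a b
    proof (rule abs_cont_on_translate)
      show "abs_cont_on ((+) c ` {a..b}) f"
        using f(1)[of "a + c" "b + c"] image_mono[OF that, of "(+) c"] by (simp add: add.commute)
    qed
    show "AE t in lebesgue. t \<in> S \<longrightarrow>
        ((\<lambda>t. f (c + t)) has_vector_derivative f' (c + t)) (at t within S)"
      using AE_lebesgue_translate[OF f(4), of c]
    proof eventually_elim
      case (elim t)
      show ?case
      proof
        assume "t \<in> S"
        with elim have "(f has_vector_derivative f' (c + t)) (at (c + t) within (+) c ` S)" by blast
        moreover have "((+) c has_vector_derivative 1) (at t within S)"
          by (auto intro!: derivative_eq_intros)
        ultimately show "((\<lambda>t. f (c + t)) has_vector_derivative f' (c + t)) (at t within S)"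
          using vector_diff_chain_within[of "(+) c" 1 t S f "f' (c + t)"] by (simp add: o_def)
      qed
    qed
  qed (use f in \<open>auto intro: L2_on_translate\<close>)
qed

lemma W12_abs_cont_on: "f \<in> W12 {a..b} \<Longrightarrow> abs_cont_on {a..b} f"
  by (auto elim: W12_E)

text \<open>Both hypotheses concern one function \<open>f\<close>, so the pieces match at
  \<open>b\<close> and no jump can arise. The one-sided derivatives at \<open>b\<close> may differ,
  but a single point is a null set.\<close>

lemma W12_join:
  fixes f :: "real \<Rightarrow> 'a::euclidean_space"
  assumes f: "f \<in> W12 {a..b}" "f \<in> W12 {b..c}" and le: "a \<le> b" "b \<le> c"
  shows "f \<in> W12 {a..c}"
proof -
  have un: "{a..c} = {a..b} \<union> {b..c}" using le by auto
  obtain f1 where f1: "L2_on {a..b} f" "L2_on {a..b} f1"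
    "AE t in lebesgue. t \<in> {a..b} \<longrightarrow> (f has_vector_derivative f1 t) (at t within {a..b})"
    using f(1) by (rule W12_E) blast
  obtain f2 where f2: "L2_on {b..c} f" "L2_on {b..c} f2"
    "AE t in lebesgue. t \<in> {b..c} \<longrightarrow> (f has_vector_derivative f2 t) (at t within {b..c})"
    using f(2) by (rule W12_E) blast
  \<comment> \<open>The value chosen at \<open>b\<close> is immaterial, because \<open>b\<close> is
    excluded almost everywhere.\<close>
  define f' where "f' t = (if t < b then f1 t else f2 t)" for t
  have "AE t in lebesgue. t \<noteq> b"
    by (rule AE_completion[OF AE_lborel_singleton])
  show ?thesis
  proof (rule W12I)
    fix a' b' assume "{a'..b'} \<subseteq> {a..c}"
    with abs_cont_on_join[OF W12_abs_cont_on[OF f(1)] W12_abs_cont_on[OF f(2)] le]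
    show "abs_cont_on {a'..b'} f" by (rule abs_cont_on_subset)
  next
    show "L2_on {a..c} f" unfolding un by (intro L2_on_Un f1 f2) auto
    \<comment> \<open>The interval is half open because \<open>f'\<close> is known to agree with
      \<open>f1\<close> only strictly to the left of \<open>b\<close>.\<close>
    have "L2_on {a..<b} f'"
    proof -
      have "L2_on {a..<b} f1" by (rule L2_on_subset[OF f1(2)]) auto
      then show ?thesis by (subst L2_on_cong[of _ _ f1]) (auto simp: f'_def)
    qed
    moreover have "L2_on {b..c} f'"
      using f2(2) by (subst L2_on_cong[of _ _ f2]) (auto simp: f'_def)
    ultimately have "L2_on ({a..<b} \<union> {b..c}) f'" by (intro L2_on_Un) auto
    moreover have "{a..<b} \<union> {b..c} = {a..c}" using le by auto
    ultimately show "L2_on {a..c} f'" by simp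
    show "AE t in lebesgue. t \<in> {a..c} \<longrightarrow> (f has_vector_derivative f' t) (at t within {a..c})"
      using \<open>AE t in lebesgue. t \<noteq> b\<close> f1(3) f2(3)
    proof eventually_elim
      case (elim t)
      \<comment> \<open>Away from \<open>b\<close>, a neighbourhood of \<open>t\<close> meets
        \<open>{a..c}\<close> in points of one piece only, so the two limits coincide.\<close>
      have "at t within {a..c} = at t within {a..b}" if "t < b"
        by (rule at_within_nhd[of _ "{..<b}"]) (use that le in auto)
      moreover have "at t within {a..c} = at t within {b..c}" if "b < t"
        by (rule at_within_nhd[of _ "{b<..}"]) (use that le in auto)
      ultimately show ?case using elim by (cases "t < b") (auto simp: f'_def)
    qed
  qed
qed

text \<open>The mean value inequality makes \<open>f\<close> Lipschitz, hence absolutely continuous,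
  and boundedness on a compact interval gives square integrability. No continuity of
  \<open>f'\<close> is assumed, which suits the DDE with merely measurable bounded
  coefficients.\<close>

lemma W12_bounded_derivative:
  fixes f :: "real \<Rightarrow> 'a::euclidean_space"
  assumes f: "\<And>t. t \<in> {a..b} \<Longrightarrow> (f has_vector_derivative f' t) (at t within {a..b})"
    and C: "\<And>t. t \<in> {a..b} \<Longrightarrow> norm (f' t) \<le> C" and "a \<le> b"
  shows "f \<in> W12 {a..b}"
proof (rule W12I)
  have cont: "continuous_on {a..b} f"
    unfolding continuous_on_eq_continuous_within
    using f by (blast intro: has_vector_derivative_continuous)
  \<comment> \<open>As a linear map the derivative is \<open>\<lambda>h. h *\<^sub>R f' t\<close>,
    whose operator norm is \<open>norm (f' t)\<close>.\<close>
  have lip: "norm (f s - f t) \<le> C * norm (s - t)" if "s \<in> {a..b}" "t \<in> {a..b}" for s t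
    using f C that
    by (intro differentiable_bound[where S = "{a..b}" and f' = "\<lambda>t h. h *\<^sub>R f' t"])
       (auto simp: has_vector_derivative_def onorm_scaleR_left onorm_id bounded_linear_ident)
  have "abs_cont_on {a..b} f"
    by (rule abs_cont_on_lipschitz_compose[OF abs_cont_on_id lip])
  then show "abs_cont_on {a'..b'} f" if "{a'..b'} \<subseteq> {a..b}" for a' b'
    using that by (rule abs_cont_on_subset)
  have "bounded (f ` {a..b})"
    using cont by (intro compact_imp_bounded compact_continuous_image) auto
  then obtain B where "\<And>t. t \<in> {a..b} \<Longrightarrow> norm (f t) \<le> B"
    unfolding bounded_iff by blast
  then show "L2_on {a..b} f"
    by (rule L2_on_bounded[OF integrable_continuous_real[OF cont]])
  \<comment> \<open>The value of the integral is irrelevant here; its existence yields measurability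
    of \<open>f'\<close>.\<close>
  have "(f' has_integral f b - f a) {a..b}"
    by (rule fundamental_theorem_of_calculus[OF \<open>a \<le> b\<close> f])
  then have "f' integrable_on {a..b}" by blast
  then show "L2_on {a..b} f'" using C by (rule L2_on_bounded)
qed (use f in auto)

section \<open>Stacked vectors and block matrices\<close>

lemma sum_UNIV_sum3:
  fixes f :: "'i::finite + 'j::finite + 'k::finite \<Rightarrow> 'a::comm_monoid_add"
  shows "sum f UNIV = (\<Sum>i\<in>UNIV. f (Inl i)) + (\<Sum>j\<in>UNIV. f (Inr (Inl j))) + (\<Sum>k\<in>UNIV. f (Inr (Inr k)))"
proof -
  have "sum f UNIV = sum f (UNIV <+> (UNIV <+> UNIV))" by (simp add: UNIV_Plus_UNIV)
  also have "\<dots> = (\<Sum>i\<in>UNIV. f (Inl i)) + ((\<Sum>j\<in>UNIV. f (Inr (Inl j))) + (\<Sum>k\<in>UNIV. f (Inr (Inr k))))"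
    by (simp only: sum.Plus finite_Plus finite o_def)
  finally show ?thesis by (simp add: add.assoc)
qed

lemma stack3_nth [simp]:
  "stack3 a b c $ Inl i = a $ i" "stack3 a b c $ Inr (Inl j) = b $ j" "stack3 a b c $ Inr (Inr k) = c $ k"
  by (simp_all add: stack3_def)

lemma vec_eq_iff_sum3:
  "p = q \<longleftrightarrow> (\<forall>i. p $ Inl i = q $ Inl i) \<and> (\<forall>j. p $ Inr (Inl j) = q $ Inr (Inl j)) \<and>
     (\<forall>k. p $ Inr (Inr k) = q $ Inr (Inr k))"
  for p q :: "'a^('i::finite + 'j::finite + 'k::finite)"
  by (simp add: vec_eq_iff split_sum_all)

lemma stack3_eq_iff: "stack3 a b c = stack3 a' b' c' \<longleftrightarrow> a = a' \<and> b = b' \<and> c = c'"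
  for a :: "'a^'i::finite" and b :: "'a^'j::finite" and c :: "'a^'k::finite"
  by (simp add: vec_eq_iff_sum3 vec_eq_iff[of a] vec_eq_iff[of b] vec_eq_iff[of c])

lemma stack3_add: "stack3 a b c + stack3 a' b' c' = stack3 (a + a') (b + b') (c + c')"
  for a :: "'a::ab_semigroup_add^'i::finite" and b :: "'a^'j::finite" and c :: "'a^'k::finite"
  by (simp add: vec_eq_iff_sum3)

lemma stack3_scaleR: "stack3 (\<alpha> *\<^sub>R a) (\<alpha> *\<^sub>R b) (\<alpha> *\<^sub>R c) = \<alpha> *\<^sub>R stack3 a b c"
  for a :: "real^'i::finite" and b :: "real^'j::finite" and c :: "real^'k::finite"
  by (simp add: vec_eq_iff_sum3)

lemma norm_stack3: "(norm (stack3 a b c))\<^sup>2 = (norm a)\<^sup>2 + (norm b)\<^sup>2 + (norm c)\<^sup>2"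
  for a :: "real^'i::finite" and b :: "real^'j::finite" and c :: "real^'k::finite"
  by (simp add: power2_norm_eq_inner inner_vec_def sum_UNIV_sum3)

lemma norm_le_norm_stack3: "norm a \<le> norm (stack3 a b c)"
  for a :: "real^'i::finite" and b :: "real^'j::finite" and c :: "real^'k::finite"
  by (rule power2_le_imp_le) (simp_all add: norm_stack3)

lemma norm_stack3_le: "norm (stack3 a b c) \<le> norm a + norm b + norm c"
  for a :: "real^'i::finite" and b :: "real^'j::finite" and c :: "real^'k::finite"
  by (rule power2_le_imp_le) (simp_all add: norm_stack3 power2_sum distrib_right)

lemma bounded_linear_stack3:
  "bounded_linear (\<lambda>a :: real^'i::finite. stack3 a (0 :: real^'j::finite) (0 :: real^'k::finite))"
  "bounded_linear (\<lambda>b :: real^'j::finite. stack3 (0 :: real^'i::finite) b (0 :: real^'k::finite))"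
  "bounded_linear (\<lambda>c :: real^'k::finite. stack3 (0 :: real^'i::finite) (0 :: real^'j::finite) c)"
  unfolding linear_conv_bounded_linear[symmetric]
  by (rule linearI; simp add: stack3_add flip: stack3_scaleR)+

text \<open>The stack is the sum of the three coordinate embeddings, each of which is
  linear.\<close>

lemma W12_stack3:
  fixes f :: "real \<Rightarrow> real^'i::finite" and g :: "real \<Rightarrow> real^'j::finite" and h :: "real \<Rightarrow> real^'k::finite"
  assumes "f \<in> W12 S" "g \<in> W12 S" "h \<in> W12 S"
  shows "(\<lambda>t. stack3 (f t) (g t) (h t)) \<in> W12 S"
proof -
  have "(\<lambda>t. stack3 (f t) 0 0 + stack3 0 (g t) 0 + stack3 0 0 (h t)) \<in> W12 S"
    by (intro W12_add W12_linear_image[OF assms(1) bounded_linear_stack3(1)]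
        W12_linear_image[OF assms(2) bounded_linear_stack3(2)]
        W12_linear_image[OF assms(3) bounded_linear_stack3(3)])
  then show ?thesis by (simp add: stack3_add)
qed

lemma stack3_mult: "stack3 A B C *v p = stack3 (A *v p) (B *v p) (C *v p)"
  by (simp add: vec_eq_iff_sum3 matrix_vector_mult_def)

lemma beside3_mult_stack3:
  "beside3 A B C *v stack3 a b c = A *v a + B *v b + C *v c"
  for a :: "real^'i::finite" and b :: "real^'j::finite" and c :: "real^'k::finite"
  by (simp add: vec_eq_iff matrix_vector_mult_def beside3_def sum_UNIV_sum3)

lemma block_matrix_mult_stack3:
  "block_matrix M *v stack3 a b c =
     stack3 (blk_A M *v a + blk_B1 M *v b + blk_B2 M *v c)
            (blk_C1 M *v a + blk_D11 M *v b + blk_D12 M *v c)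
            (blk_C2 M *v a + blk_D21 M *v b + blk_D22 M *v c)"
  by (simp add: block_matrix_def stack3_mult beside3_mult_stack3)

text \<open>The norm of a matrix as a vector of rows is the Frobenius norm, so the bound is
  Cauchy-Schwarz applied to each row. It is also the norm in which the coefficients are assumed
  bounded.\<close>

lemma norm_matrix_vector_mult_le: "norm (A *v x) \<le> norm A * norm x"
  for A :: "real^'n::finite^'m::finite"
proof -
  have "norm (A *v x) \<le> L2_set (\<lambda>i. norm x * norm (A $ i)) UNIV"
    unfolding norm_vec_def[of "A *v x"]
  proof (rule L2_set_mono)
    show "norm ((A *v x) $ i) \<le> norm x * norm (A $ i)" for i
      using Cauchy_Schwarz_ineq2[of "A $ i" x]
      by (simp add: matrix_vector_mul_component mult.commute)
  qed auto
  also have "\<dots> = norm x * L2_set (\<lambda>i. norm (A $ i)) UNIV"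
    by (simp add: L2_set_right_distrib)
  finally show ?thesis by (simp add: norm_vec_def[of A] mult.commute)
qed

section \<open>Solutions of the delay-differential equation\<close>

text \<open>A non-integrable \<open>g\<close> has integral 0 by convention.\<close>

lemma norm_set_lebesgue_integral_le:
  fixes g :: "real \<Rightarrow> 'a::euclidean_space"
  assumes "\<And>s. s \<in> {a..b} \<Longrightarrow> norm (g s) \<le> C" "a \<le> b" "0 \<le> C"
  shows "norm (LINT s:{a..b}|lebesgue. g s) \<le> C * (b - a)"
proof (cases "set_integrable lebesgue {a..b} g")
  case True
  have "norm (LINT s:{a..b}|lebesgue. g s) \<le> (LINT s:{a..b}|lebesgue. C)"
    unfolding set_lebesgue_integral_def
  proof (rule Bochner_Integration.integral_norm_bound_integral)
    show "integrable lebesgue (\<lambda>s. indicat_real {a..b} s *\<^sub>R C)"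
      using absolutely_integrable_on_const[of "{a..b}" C] by (simp add: set_integrable_def)
    show "norm (indicat_real {a..b} s *\<^sub>R g s) \<le> indicat_real {a..b} s *\<^sub>R C" for s
      using assms(1)[of s] by (simp add: indicator_def)
  qed (use True in \<open>simp add: set_integrable_def\<close>)
  also have "\<dots> = C * (b - a)"
    using assms(2) by (simp add: set_lebesgue_integral_def mult.commute)
  finally show ?thesis .
next
  case False
  then show ?thesis
    using assms(2,3) by (simp add: set_lebesgue_integral_def set_integrable_def not_integrable_integral_eq)
qed

lemma W12_bounded_image:
  assumes "f \<in> W12 {a..b}"
  shows "bounded (f ` {a..b})"
  using abs_cont_on_imp_continuous_on[OF W12_abs_cont_on[OF assms]]
  by (intro compact_imp_bounded compact_continuous_image) auto

text \<open>The vanishing of \<open>f\<close> includes the point 0, where the zero function on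
  \<open>{a..0}\<close> is therefore glued to \<open>f\<close> without a jump.\<close>

lemma W12_extend_zero:
  assumes "f \<in> W12 {0..}" "\<forall>s\<le>0. f s = 0" "a \<le> 0" "0 \<le> b"
  shows "f \<in> W12 {a..b}"
proof -
  have "(\<lambda>_. 0) \<in> W12 {a..0}"
    using \<open>a \<le> 0\<close> by (intro W12_bounded_derivative[where f' = "\<lambda>_. 0" and C = 0]) auto
  then have "f \<in> W12 {a..0}" by (rule W12_cong) (use assms in auto)
  moreover have "f \<in> W12 {0..b}" by (rule W12_subset[OF assms(1)]) auto
  ultimately show ?thesis using assms(3,4) by (rule W12_join)
qed

text \<open>For times in \<open>{0..T}\<close> the right-hand side of the DDE reads the signals only
  on \<open>{-\<tau> K..T}\<close>. There \<open>x\<close> is bounded by continuity of the history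
  \<open>x0\<close> and of the differentiable \<open>x\<close>, so each term is a bounded
  coefficient applied to a bounded signal.\<close>

lemma satisfies_DDE_derivative_bounded:
  fixes E :: "('n::finite, 'm::finite, 'p::finite, 'q::finite, 'r::finite) dde"
  assumes dde: "satisfies_DDE K \<tau> E w u x0 x z y"
    and \<tau>: "\<And>i. i \<in> {1..K} \<Longrightarrow> 0 < \<tau> i \<and> \<tau> i \<le> \<tau> K"
    and \<tau>K: "0 \<le> \<tau> K"
    and bdd: "\<And>i. i \<in> {1..K} \<Longrightarrow> bounded ((\<lambda>s. block_matrix (dde_distr E i s)) ` {-\<tau> i..0})"
    and w: "bounded (w ` {-\<tau> K..T})" and u: "bounded (u ` {-\<tau> K..T})"
  shows "\<exists>C. \<forall>t\<in>{0..T}. norm (vector_derivative x (at t within {0..})) \<le> C"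
proof -
  let ?X = "\<lambda>t. stack3 (x t) (w t) (u t)"
  have "continuous_on {0..T} x"
    using dde differentiable_imp_continuous_on continuous_on_subset
    unfolding satisfies_DDE_def by (metis Icc_subset_Ici_iff order_refl)
  then have "bounded (x ` {0..T})"
    by (intro compact_imp_bounded compact_continuous_image) auto
  moreover have "bounded (x ` {-\<tau> K..0})"
    using dde W12_bounded_image[of x0 "- \<tau> K" 0] by (simp add: satisfies_DDE_def)
  ultimately have "bounded (x ` {-\<tau> K..0} \<union> x ` {0..T})" by simp
  then have "bounded (x ` {-\<tau> K..T})"
    unfolding image_Un[symmetric] by (rule bounded_subset) (intro image_mono, auto)
  with w u obtain cx cw cu where
    c: "\<And>t. t \<in> {-\<tau> K..T} \<Longrightarrow> norm (x t) \<le> cx \<and> norm (w t) \<le> cw \<and> norm (u t) \<le> cu"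
    unfolding bounded_iff by (metis imageI)
  \<comment> \<open>The absolute value guarantees \<open>0 \<le> c\<close> even when
    \<open>{-\<tau> K..T}\<close> is empty and the three bounds say nothing.\<close>
  define c where "c = \<bar>cx + cw + cu\<bar>"
  have c0: "0 \<le> c" by (simp add: c_def)
  have X: "norm (?X t) \<le> c" if "t \<in> {-\<tau> K..T}" for t
    using norm_stack3_le[of "x t" "w t" "u t"] c[OF that] unfolding c_def by linarith
  obtain B where B: "\<And>i s. i \<in> {1..K} \<Longrightarrow> s \<in> {-\<tau> i..0} \<Longrightarrow> norm (block_matrix (dde_distr E i s)) \<le> B i"
  proof -
    have "\<forall>i\<in>{1..K}. \<exists>B. \<forall>s\<in>{-\<tau> i..0}. norm (block_matrix (dde_distr E i s)) \<le> B"
      using bdd unfolding bounded_iff by blast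
    then show thesis using that by (metis bchoice)
  qed
  \<comment> \<open>One summand for each term of the DDE. The factor \<open>0 - - \<tau> i\<close>
    is the length of the integration interval, written as
    \<open>norm_set_lebesgue_integral_le\<close> returns it.\<close>
  define C where "C = norm (block_matrix (dde_now E)) * c
     + (\<Sum>i=1..K. norm (block_matrix (dde_delay E i)) * c) + (\<Sum>i=1..K. \<bar>B i\<bar> * c * (0 - - \<tau> i))"
  have "norm (vector_derivative x (at t within {0..})) \<le> C" if t: "t \<in> {0..T}" for t
  proof -
    \<comment> \<open>The derivative is the top block of the left-hand side, so it is enough to
      bound the whole stack.\<close>
    have "norm (vector_derivative x (at t within {0..}))
        \<le> norm (stack3 (vector_derivative x (at t within {0..})) (z t) (y t))"
      by (rule norm_le_norm_stack3)
    also have "stack3 (vector_derivative x (at t within {0..})) (z t) (y t) =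
        block_matrix (dde_now E) *v ?X t
        + (\<Sum>i=1..K. block_matrix (dde_delay E i) *v ?X (t - \<tau> i))
        + (\<Sum>i=1..K. LINT s:{-\<tau> i..0}|lebesgue. block_matrix (dde_distr E i s) *v ?X (t + s))"
      using dde t by (simp add: satisfies_DDE_def)
    also have "norm \<dots> \<le> C"
      unfolding C_def
    proof (intro norm_triangle_mono sum_norm_le)
      have K: "0 < \<tau> i \<and> \<tau> i \<le> \<tau> K" if "i \<in> {1..K}" for i using \<tau> that by blast
      \<comment> \<open>It is applied at \<open>t\<close>, \<open>t - \<tau> i\<close> and
        \<open>t + s\<close>, all of which stay in \<open>{-\<tau> K..T}\<close> because
        \<open>\<tau> i \<le> \<tau> K\<close>.\<close>
      have mult: "norm (A *v ?X s) \<le> norm A * c" if "s \<in> {-\<tau> K..T}"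
        for s and A :: "real^('n + 'm + 'p)^('n + 'q + 'r)"
        by (rule order.trans[OF norm_matrix_vector_mult_le mult_left_mono[OF X[OF that]]]) simp
      show "norm (block_matrix (dde_now E) *v ?X t) \<le> norm (block_matrix (dde_now E)) * c"
        using \<tau>K t by (intro mult) auto
      show "norm (block_matrix (dde_delay E i) *v ?X (t - \<tau> i)) \<le> norm (block_matrix (dde_delay E i)) * c"
        if "i \<in> {1..K}" for i
        using K[OF that] t by (intro mult) auto
      show "norm (LINT s:{-\<tau> i..0}|lebesgue. block_matrix (dde_distr E i s) *v ?X (t + s))
          \<le> \<bar>B i\<bar> * c * (0 - - \<tau> i)" if i: "i \<in> {1..K}" for i
      proof (rule norm_set_lebesgue_integral_le)
        fix s assume s: "s \<in> {-\<tau> i..0}"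
        have "norm (block_matrix (dde_distr E i s) *v ?X (t + s)) \<le> norm (block_matrix (dde_distr E i s)) * c"
          using K[OF i] t s by (intro mult) auto
        also have "\<dots> \<le> \<bar>B i\<bar> * c"
          using B[OF i s] c0 by (intro mult_right_mono) auto
        finally show "norm (block_matrix (dde_distr E i s) *v ?X (t + s)) \<le> \<bar>B i\<bar> * c" .
      qed (use K[OF i] c0 in auto)
    qed
    finally show ?thesis .
  qed
  then show ?thesis by blast
qed

section \<open>Equivalence of the DDE and its DDF form\<close>

theorem lemma1:
  fixes K :: nat and \<tau> :: "nat \<Rightarrow> real"
    and E :: "('n::finite, 'm::finite, 'p::finite, 'q::finite, 'r::finite) dde"
    and F :: "('n, 'm, 'p, 'q, 'r, 'n + 'm + 'p, 'n + 'q + 'r) ddf"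
    and w :: "real \<Rightarrow> real^'m" and u :: "real \<Rightarrow> real^'p"
    and x0 x :: "real \<Rightarrow> real^'n" and z :: "real \<Rightarrow> real^'q" and y :: "real \<Rightarrow> real^'r"
    and r :: "nat \<Rightarrow> real \<Rightarrow> real^('n + 'm + 'p)" and v :: "real \<Rightarrow> real^('n + 'q + 'r)"
  assumes "1 \<le> K" and "0 < \<tau> 1" and "strict_mono_on {1..K} \<tau>"
    and "\<forall>i\<in>{1..K}.
           set_borel_measurable lebesgue {-\<tau> i..0} (\<lambda>s. block_matrix (dde_distr E i s)) \<and>
           bounded ((\<lambda>s. block_matrix (dde_distr E i s)) ` {-\<tau> i..0})"
    and "ddf_A0 F = blk_A (dde_now E)"
    and "ddf_B1 F = blk_B1 (dde_now E)" and "ddf_B2 F = blk_B2 (dde_now E)"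
    and "ddf_C1 F = blk_C1 (dde_now E)" and "ddf_C2 F = blk_C2 (dde_now E)"
    and "ddf_D11 F = blk_D11 (dde_now E)" and "ddf_D12 F = blk_D12 (dde_now E)"
    and "ddf_D21 F = blk_D21 (dde_now E)" and "ddf_D22 F = blk_D22 (dde_now E)"
    and "stack3 (ddf_Bv F) (ddf_D1v F) (ddf_D2v F) = mat 1"
    and "\<forall>i\<in>{1..K}. beside3 (ddf_Cr F i) (ddf_Br1 F i) (ddf_Br2 F i) = mat 1"
    and "\<forall>i\<in>{1..K}. ddf_Drv F i = 0"
    and "\<forall>i\<in>{1..K}. ddf_Cv F i = block_matrix (dde_delay E i)"
    and "\<forall>i\<in>{1..K}. \<forall>s\<in>{-\<tau> i..0}. ddf_Cvd F i s = block_matrix (dde_distr E i s)"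
    and "w \<in> W12 {0..}" and "\<forall>s\<le>0. w s = 0"
    and "u \<in> W12 {0..}" and "\<forall>s\<le>0. u s = 0"
    and "x0 \<in> W12 {-\<tau> K..0}"
    and "\<forall>i\<in>{1..K}. \<forall>t\<ge>-\<tau> i. r i t = stack3 (x t) (w t) (u t)"
    and "\<forall>t\<ge>0. v t = ddf_v K \<tau> F r t"
  shows "satisfies_DDE K \<tau> E w u x0 x z y \<longleftrightarrow>
         satisfies_DDF K \<tau> F w u (x0 0) (\<lambda>i s. stack3 (x0 s) 0 0) x z y r v"
proof -
  have \<tau>_le: "\<tau> i \<le> \<tau> j" if "i \<in> {1..K}" "j \<in> {1..K}" "i \<le> j" for i j
    using strict_mono_on_leD[OF assms(3)] that by blast
  have \<tau>: "0 < \<tau> i \<and> \<tau> i \<le> \<tau> K" if "i \<in> {1..K}" for i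
    using \<tau>_le[of 1 i] \<tau>_le[of i K] assms(1,2) that by auto
  have \<tau>K: "0 < \<tau> K" using \<tau> assms(1) by auto
  let ?X = "\<lambda>t. stack3 (x t) (w t) (u t)"
  have r: "r i t = ?X t" if "i \<in> {1..K}" "t \<ge> -\<tau> i" for i t
    using assms(24) that by blast
  \<comment> \<open>The identity block row reproduces the stack, and \<open>ddf_Drv F i = 0\<close>
    allows any \<open>v'\<close>. Leaving \<open>v'\<close> free lets the same fact serve the
    equation for \<open>r i\<close> and the sewing condition.\<close>
  have r_eq: "?X t = ddf_Cr F i *v x t + ddf_Br1 F i *v w t + ddf_Br2 F i *v u t + ddf_Drv F i *v v'"
    if "i \<in> {1..K}" for i t v'
    using beside3_mult_stack3[of "ddf_Cr F i" "ddf_Br1 F i" "ddf_Br2 F i" "x t" "w t" "u t"] assms(15,16) that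
    by simp
  \<comment> \<open>For \<open>t \<ge> 0\<close> both \<open>t - \<tau> i\<close> and
    \<open>t + s\<close> are at least \<open>-\<tau> i\<close>, the range on which
    \<open>r i\<close> is prescribed.\<close>
  have v: "ddf_v K \<tau> F r t = (\<Sum>i=1..K. block_matrix (dde_delay E i) *v ?X (t - \<tau> i))
      + (\<Sum>i=1..K. LINT s:{-\<tau> i..0}|lebesgue. block_matrix (dde_distr E i s) *v ?X (t + s))"
    if "t \<ge> 0" for t
  proof -
    have "(\<Sum>i=1..K. ddf_Cv F i *v r i (t - \<tau> i)) = (\<Sum>i=1..K. block_matrix (dde_delay E i) *v ?X (t - \<tau> i))"
      using that assms(17) by (intro sum.cong) (auto simp: r)
    moreover have "(\<Sum>i=1..K. LINT s:{-\<tau> i..0}|lebesgue. ddf_Cvd F i s *v r i (t + s)) =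
        (\<Sum>i=1..K. LINT s:{-\<tau> i..0}|lebesgue. block_matrix (dde_distr E i s) *v ?X (t + s))"
    proof (intro sum.cong set_lebesgue_integral_cong allI impI refl)
      fix i s assume "i \<in> {1..K}" "s \<in> {-\<tau> i..0}"
      with that assms(18) r[of i "t + s"] show "ddf_Cvd F i s *v r i (t + s) = block_matrix (dde_distr E i s) *v ?X (t + s)"
        by simp
    qed simp
    ultimately show ?thesis by (simp only: ddf_v_def)
  qed
  \<comment> \<open>The stacked identity \<open>[B_v; D_1v; D_2v]\<close> cuts \<open>p\<close> into
    its three blocks, so the single DDE equation is equivalent to the three DDF rows. Both
    directions use it with \<open>p = v t\<close>.\<close>
  have eqn: "stack3 xd z' y' = block_matrix (dde_now E) *v ?X t + p \<longleftrightarrow>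
      xd = ddf_A0 F *v x t + ddf_B1 F *v w t + ddf_B2 F *v u t + ddf_Bv F *v p \<and>
      z' = ddf_C1 F *v x t + ddf_D11 F *v w t + ddf_D12 F *v u t + ddf_D1v F *v p \<and>
      y' = ddf_C2 F *v x t + ddf_D21 F *v w t + ddf_D22 F *v u t + ddf_D2v F *v p" for xd z' y' t p
  proof -
    have p: "stack3 (ddf_Bv F *v p) (ddf_D1v F *v p) (ddf_D2v F *v p) = p"
      unfolding stack3_mult[symmetric] assms(14) by (rule matrix_vector_mul_lid)
    have "block_matrix (dde_now E) *v ?X t + stack3 (ddf_Bv F *v p) (ddf_D1v F *v p) (ddf_D2v F *v p) =
      stack3 (ddf_A0 F *v x t + ddf_B1 F *v w t + ddf_B2 F *v u t + ddf_Bv F *v p)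
        (ddf_C1 F *v x t + ddf_D11 F *v w t + ddf_D12 F *v u t + ddf_D1v F *v p)
        (ddf_C2 F *v x t + ddf_D21 F *v w t + ddf_D22 F *v u t + ddf_D2v F *v p)"
      by (simp only: block_matrix_mult_stack3 stack3_add assms(5-13))
    then show ?thesis by (simp only: p stack3_eq_iff)
  qed
  show ?thesis
  proof

    \<comment> \<open>From the DDE to the DDF\<close>
    assume dde: "satisfies_DDE K \<tau> E w u x0 x z y"
    have x: "x differentiable_on {0..}" "\<And>s. s \<in> {-\<tau> K..0} \<Longrightarrow> x s = x0 s"
      using dde by (auto simp: satisfies_DDE_def)
    have X0: "?X s = stack3 (x0 s) 0 0" if "s \<in> {-\<tau> K..0}" for s
      using x(2)[OF that] assms(20,22) that by simp
    \<comment> \<open>Starting at the longest delay, this interval contains every window of every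
      \<open>r i\<close> up to time \<open>T\<close>.\<close>
    have X_W12: "?X \<in> W12 {-\<tau> K..T}" if "0 \<le> T" for T
    proof -
      have wu: "w \<in> W12 {-\<tau> K..T}" "u \<in> W12 {-\<tau> K..T}"
        using assms(19-22) \<tau>K that by (auto intro: W12_extend_zero)
      have "x \<in> W12 {-\<tau> K..0}"
        using assms(23) by (rule W12_cong) (simp add: x(2))
      moreover have "x \<in> W12 {0..T}"
      proof -
        obtain C where C: "\<And>t. t \<in> {0..T} \<Longrightarrow> norm (vector_derivative x (at t within {0..})) \<le> C"
          using satisfies_DDE_derivative_bounded[OF dde \<tau> less_imp_le[OF \<tau>K] _
              W12_bounded_image[OF wu(1)] W12_bounded_image[OF wu(2)]] assms(4) by blast
        \<comment> \<open>The bound concerns the derivative within the half-line; that derivative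
          also serves within \<open>{0..T}\<close>, including at the right endpoint.\<close>
        have "(x has_vector_derivative vector_derivative x (at t within {0..})) (at t within {0..T})"
          if "t \<in> {0..T}" for t
        proof (rule has_vector_derivative_within_subset)
          show "(x has_vector_derivative vector_derivative x (at t within {0..})) (at t within {0..})"
            using x(1) that by (simp add: differentiable_on_def vector_derivative_works[symmetric])
        qed auto
        then show ?thesis using C \<open>0 \<le> T\<close> by (rule W12_bounded_derivative)
      qed
      ultimately have "x \<in> W12 {-\<tau> K..T}" using \<tau>K that by (auto intro: W12_join)
      then show ?thesis using wu by (rule W12_stack3)
    qed
    show "satisfies_DDF K \<tau> F w u (x0 0) (\<lambda>i s. stack3 (x0 s) 0 0) x z y r v"
      unfolding satisfies_DDF_def
    proof (intro conjI ballI allI impI)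
      fix i assume i: "i \<in> {1..K}"
      have "?X \<in> W12 {-\<tau> i..0}"
        using X_W12[of 0] \<tau>[OF i] by (auto intro: W12_subset)
      then show "(\<lambda>s. stack3 (x0 s) (0 :: real^'m) (0 :: real^'p)) \<in> W12 {-\<tau> i..0}"
        by (rule W12_cong) (use \<tau>[OF i] in \<open>auto intro: X0\<close>)
      show "r i s = stack3 (x0 s) 0 0" if "s \<in> {-\<tau> i..0}" for s
        using r[OF i] X0[of s] \<tau>[OF i] that by auto
      fix t :: real assume t: "0 \<le> t"
      \<comment> \<open>The shifted window is \<open>{t - \<tau> i..t}\<close>, so
        \<open>T = t\<close> suffices.\<close>
      have "?X \<in> W12 ((+) t ` {-\<tau> i..0})"
        by (rule W12_subset[OF X_W12[OF t]]) (use \<tau>[OF i] t in auto)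
      then have "(\<lambda>s. ?X (t + s)) \<in> W12 {-\<tau> i..0}" by (rule W12_translate)
      then show "(\<lambda>s. r i (t + s)) \<in> W12 {-\<tau> i..0}"
        by (rule W12_cong) (use r[OF i] t in auto)
      show "r i t = ddf_Cr F i *v x t + ddf_Br1 F i *v w t + ddf_Br2 F i *v u t + ddf_Drv F i *v v t"
        using r[OF i] r_eq[OF i] \<tau>[OF i] t by simp
    next
      show "sewing_condition K \<tau> F (x0 0) (\<lambda>i s. stack3 (x0 s) 0 0)"
        unfolding sewing_condition_def
      proof
        fix i assume i: "i \<in> {1..K}"
        \<comment> \<open>This is \<open>r_eq\<close> at time 0, where \<open>x 0 = x0 0\<close> and
          both inputs vanish; the free \<open>v'\<close> takes the value of the bracket in the
          sewing condition.\<close>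
        show "stack3 (x0 0) 0 0 = ddf_Cr F i *v x0 0 + ddf_Drv F i *v ddf_v K \<tau> F (\<lambda>i s. stack3 (x0 s) 0 0) 0"
          using r_eq[OF i, of 0] x(2)[of 0] assms(20,22) \<tau>K by simp
      qed
      fix t :: real assume t: "0 \<le> t"
      have "stack3 (vector_derivative x (at t within {0..})) (z t) (y t) =
          block_matrix (dde_now E) *v ?X t + v t"
        using dde t assms(25) v[OF t] by (simp add: satisfies_DDE_def add.assoc)
      note D = this[unfolded eqn]
      show "vector_derivative x (at t within {0..}) =
          ddf_A0 F *v x t + ddf_B1 F *v w t + ddf_B2 F *v u t + ddf_Bv F *v v t"
        "z t = ddf_C1 F *v x t + ddf_D11 F *v w t + ddf_D12 F *v u t + ddf_D1v F *v v t"
        "y t = ddf_C2 F *v x t + ddf_D21 F *v w t + ddf_D22 F *v u t + ddf_D2v F *v v t"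
        using D by blast+
      show "v t = ddf_v K \<tau> F r t" using assms(25) t by blast
    qed (use x \<tau>K in auto)
  next

    \<comment> \<open>From the DDF to the DDE\<close>
    assume ddf: "satisfies_DDF K \<tau> F w u (x0 0) (\<lambda>i s. stack3 (x0 s) 0 0) x z y r v"
    show "satisfies_DDE K \<tau> E w u x0 x z y"
      unfolding satisfies_DDE_def
    proof (intro conjI ballI allI impI)
      show "x differentiable_on {0..}" using ddf by (simp add: satisfies_DDF_def)
      fix s assume s: "s \<in> {-\<tau> K..0}"
      \<comment> \<open>Index \<open>K\<close> is chosen because its delay is the longest:
        \<open>r K\<close> alone carries the history on all of \<open>{-\<tau> K..0}\<close>. Its
        first block is \<open>x\<close>, which gives the initial condition.\<close>
      have "r K s = stack3 (x0 s) 0 0" using ddf assms(1) s by (auto simp: satisfies_DDF_def)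
      moreover have "r K s = ?X s" using assms(1) s by (intro r) auto
      ultimately show "x s = x0 s" by (simp add: stack3_eq_iff)
    next
      fix t :: real assume t: "0 \<le> t"
      have "stack3 (vector_derivative x (at t within {0..})) (z t) (y t) =
          block_matrix (dde_now E) *v ?X t + v t"
        unfolding eqn using ddf t by (simp add: satisfies_DDF_def)
      then show "stack3 (vector_derivative x (at t within {0..})) (z t) (y t) =
          block_matrix (dde_now E) *v ?X t
          + (\<Sum>i=1..K. block_matrix (dde_delay E i) *v ?X (t - \<tau> i))
          + (\<Sum>i=1..K. LINT s:{-\<tau> i..0}|lebesgue. block_matrix (dde_distr E i s) *v ?X (t + s))"
        using assms(25) v[OF t] t by (simp add: add.assoc)
    qed (rule assms(23))
  qed
qed

end
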